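(* Let $S_1\ge 2$ be arbitrary. Every $S_1\times 1\times\dots\times 1$-setting family of $N$-partite joint measurements satisfying the nonsignaling condition admits an LHV model.
   Context: An $S_1\times\dots\times S_N$-setting family $\mathcal{E}$ of $N$-partite joint measurements consists of positive integers $N,S_1,\dots,S_N$, an outcome set $\Lambda_n^{(s_n)}$ (an arbitrary measurable space; outcomes need not be real numbers and may be of any spectral type, discrete or continuous) for each site $n\in\{1,\dots,N\}$ and setting $s_n\in\{1,\dots,S_n\}$, and, for each $(s_1,\dots,s_N)$ with $s_n\in\{1,\dots,S_n\}$, a probability measure $P^{(\mathcal{E})}_{(s_1,\dots,s_N)}$ on $\Lambda_1^{(s_1)}\times\dots\times\Lambda_N^{(s_N)}$. An $S_1\times1\times\dots\times1$-setting family is one with $S_2=\dots=S_N=1$. Nonsignaling condition: for any $(s_1,\dots,s_N)$, $(s'_1,\dots,s'_N)$ and any sites $1\le n_1<\dots<n_M\le N$, $1\le M<N$, with $s_{n_j}=s'_{n_j}$ for $j=1,\dots,M$, the marginals of $P^{(\mathcal{E})}_{(s_1,\dots,s_N)}$ and $P^{(\mathcal{E})}_{(s'_1,\dots,s'_N)}$ on $\Lambda_{n_1}^{(s_{n_1})}\times\dots\times\Lambda_{n_M}^{(s_{n_M})}$ coincide. LHV model: the family $\mathcal{E}$ (with $S_1+\dots+S_N>N$) admits a local hidden variable (LHV) model if there exist a single probability space $(\Omega,\mathcal{F}_\Omega,\nu_{\mathcal{E}})$ and, for each $n$ and $s_n$, a conditional probability distribution $P_n^{(s_n)}(\cdot|\omega)$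 on $\Lambda_n^{(s_n)}$, defined for $\nu_{\mathcal{E}}$-almost every $\omega$, with $\omega\mapsto P_n^{(s_n)}(D|\omega)$ measurable for each measurable $D$, and depending only on the setting $s_n$ at site $n$, such that for all $(s_1,\dots,s_N)$ and all measurable $D_n\subseteq\Lambda_n^{(s_n)}$, $$P^{(\mathcal{E})}_{(s_1,\dots,s_N)}(D_1\times\dots\times D_N)=\int_\Omega P_1^{(s_1)}(D_1|\omega)\cdots P_N^{(s_N)}(D_N|\omega)\,\nu_{\mathcal{E}}(d\omega).$$
   Formalization: For arbitrary outcome spaces the conditional probability distributions are meant in the Radon–Nikodym sense (null sets may depend on the events); they are probability measures for a.e. ω when the outcome spaces at site 1 are standard Borel, as the claim fails otherwise. *)

theory Defs
  imports "HOL-Probability.Probability"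
begin

text \<open>
  Sites are \<open>1, \<dots>, N\<close> and the settings at site \<open>n\<close> are \<open>1, \<dots>, S n\<close>. The outcome space of setting
  \<open>s\<close> at site \<open>n\<close> is the measurable space underlying \<open>L n s\<close>; the measure carried by \<open>L n s\<close> is
  irrelevant. Outcome spaces may be unrelated to each other; a single type \<open>'a\<close> hosts all of
  them, which is no restriction because it can be taken to be a sum type.
\<close>

definition settings :: "nat \<Rightarrow> (nat \<Rightarrow> nat) \<Rightarrow> (nat \<Rightarrow> nat) set" where
  "settings N S = (\<Pi>\<^sub>E n\<in>{1..N}. {1..S n})"

definition outcome_space ::
  "(nat \<Rightarrow> nat \<Rightarrow> 'a measure) \<Rightarrow> nat set \<Rightarrow> (nat \<Rightarrow> nat) \<Rightarrow> (nat \<Rightarrow> 'a) measure" where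
  "outcome_space L J s = (\<Pi>\<^sub>M n\<in>J. L n (s n))"

definition measurement_family ::
  "nat \<Rightarrow> (nat \<Rightarrow> nat) \<Rightarrow> (nat \<Rightarrow> nat \<Rightarrow> 'a measure) \<Rightarrow> ((nat \<Rightarrow> nat) \<Rightarrow> (nat \<Rightarrow> 'a) measure) \<Rightarrow> bool" where
  "measurement_family N S L P \<longleftrightarrow>
     1 \<le> N \<and> (\<forall>n\<in>{1..N}. 1 \<le> S n) \<and>
     (\<forall>s\<in>settings N S. prob_space (P s) \<and> sets (P s) = sets (outcome_space L {1..N} s))"

definition marginal ::
  "(nat \<Rightarrow> nat \<Rightarrow> 'a measure) \<Rightarrow> ((nat \<Rightarrow> nat) \<Rightarrow> (nat \<Rightarrow> 'a) measure) \<Rightarrow> nat set \<Rightarrow> (nat \<Rightarrow> nat) \<Rightarrow> (nat \<Rightarrow> 'a) measure" where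
  "marginal L P J s = distr (P s) (outcome_space L J s) (\<lambda>x. restrict x J)"

definition nonsignaling ::
  "nat \<Rightarrow> (nat \<Rightarrow> nat) \<Rightarrow> (nat \<Rightarrow> nat \<Rightarrow> 'a measure) \<Rightarrow> ((nat \<Rightarrow> nat) \<Rightarrow> (nat \<Rightarrow> 'a) measure) \<Rightarrow> bool" where
  "nonsignaling N S L P \<longleftrightarrow>
     (\<forall>s\<in>settings N S. \<forall>s'\<in>settings N S. \<forall>J. J \<noteq> {} \<and> J \<subset> {1..N} \<and> (\<forall>n\<in>J. s n = s' n) \<longrightarrow>
        marginal L P J s = marginal L P J s')"

text \<open>
  A conditional probability distribution \<open>k D \<omega>\<close> is determined only for almost every \<open>\<omega>\<close>. In
  \<open>conditional_distribution\<close> the exceptional null set may depend on the events involved, as for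
  conditional probabilities obtained from the Radon-Nikodym theorem; in
  \<open>regular_conditional_distribution\<close> a single null set serves all events, so that \<open>k\<close> is almost
  everywhere a probability measure. On arbitrary measurable spaces regular versions need not
  exist, on standard Borel spaces they always do.
\<close>

definition conditional_distribution ::
  "'w measure \<Rightarrow> 'a measure \<Rightarrow> ('a set \<Rightarrow> 'w \<Rightarrow> real) \<Rightarrow> bool" where
  "conditional_distribution \<nu> M k \<longleftrightarrow>
     (\<forall>D\<in>sets M. k D \<in> borel_measurable \<nu>) \<and>
     (\<forall>D\<in>sets M. AE \<omega> in \<nu>. 0 \<le> k D \<omega>) \<and>
     (AE \<omega> in \<nu>. k (space M) \<omega> = 1) \<and>
     (\<forall>D::nat \<Rightarrow> 'a set. range D \<subseteq> sets M \<and> disjoint_family D \<longrightarrow>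
        (AE \<omega> in \<nu>. (\<lambda>i. k (D i) \<omega>) sums k (\<Union>i. D i) \<omega>))"

definition regular_conditional_distribution ::
  "'w measure \<Rightarrow> 'a measure \<Rightarrow> ('a set \<Rightarrow> 'w \<Rightarrow> real) \<Rightarrow> bool" where
  "regular_conditional_distribution \<nu> M k \<longleftrightarrow>
     (\<forall>D\<in>sets M. k D \<in> borel_measurable \<nu>) \<and>
     (AE \<omega> in \<nu>. \<exists>Q. prob_space Q \<and> sets Q = sets M \<and> (\<forall>D\<in>sets M. k D \<omega> = measure Q D))"

lemma regular_conditional_distribution_imp:
  assumes "regular_conditional_distribution \<nu> M k"
  shows "conditional_distribution \<nu> M k"
proof -
  have ae: "AE \<omega> in \<nu>. \<exists>Q. prob_space Q \<and> sets Q = sets M \<and> (\<forall>D\<in>sets M. k D \<omega> = measure Q D)"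
    using assms by (simp add: regular_conditional_distribution_def)
  have "AE \<omega> in \<nu>. 0 \<le> k D \<omega>" if "D \<in> sets M" for D
    using ae by eventually_elim (use that in auto)
  moreover have "AE \<omega> in \<nu>. k (space M) \<omega> = 1"
    using ae
  proof eventually_elim
    case (elim \<omega>)
    then obtain Q where Q: "prob_space Q" "sets Q = sets M" "\<forall>D\<in>sets M. k D \<omega> = measure Q D"
      by blast
    then show ?case
      using prob_space.prob_space[OF Q(1)] sets_eq_imp_space_eq[OF Q(2)] by auto
  qed
  moreover have "AE \<omega> in \<nu>. (\<lambda>i. k (D i) \<omega>) sums k (\<Union>i. D i) \<omega>"
    if D: "range D \<subseteq> sets M" "disjoint_family D" for D :: "nat \<Rightarrow> 'b set"
    using ae
  proof eventually_elim
    case (elim \<omega>)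
    then obtain Q where Q: "prob_space Q" "sets Q = sets M" "\<forall>D\<in>sets M. k D \<omega> = measure Q D"
      by blast
    interpret prob_space Q by fact
    have "(\<lambda>i. measure Q (D i)) sums measure Q (\<Union>i. D i)"
      using D Q(2) by (intro finite_measure_UNION) auto
    moreover have "k (D i) \<omega> = measure Q (D i)" for i
      using D Q(3) by auto
    moreover have "k (\<Union>i. D i) \<omega> = measure Q (\<Union>i. D i)"
      using D Q(3) by auto
    ultimately show ?case by simp
  qed
  ultimately show ?thesis
    using assms by (simp add: conditional_distribution_def regular_conditional_distribution_def)
qed

definition LHV_representation ::
  "nat \<Rightarrow> (nat \<Rightarrow> nat) \<Rightarrow> (nat \<Rightarrow> nat \<Rightarrow> 'a measure) \<Rightarrow> ((nat \<Rightarrow> nat) \<Rightarrow> (nat \<Rightarrow> 'a) measure) \<Rightarrow>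
   'w measure \<Rightarrow> (nat \<Rightarrow> nat \<Rightarrow> 'a set \<Rightarrow> 'w \<Rightarrow> real) \<Rightarrow> bool" where
  "LHV_representation N S L P \<nu> k \<longleftrightarrow>
     (\<forall>s\<in>settings N S. \<forall>D. (\<forall>n\<in>{1..N}. D n \<in> sets (L n (s n))) \<longrightarrow>
        measure (P s) (\<Pi>\<^sub>E n\<in>{1..N}. D n) = (\<integral>\<omega>. (\<Prod>n\<in>{1..N}. k n (s n) (D n) \<omega>) \<partial>\<nu>))"

text \<open>
  The type \<open>'w\<close> of hidden variables is an explicit parameter, as one cannot quantify over types
  inside a formula.
\<close>

definition admits_LHV_model ::
  "'w itself \<Rightarrow> nat \<Rightarrow> (nat \<Rightarrow> nat) \<Rightarrow> (nat \<Rightarrow> nat \<Rightarrow> 'a measure) \<Rightarrow>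
   ((nat \<Rightarrow> nat) \<Rightarrow> (nat \<Rightarrow> 'a) measure) \<Rightarrow> bool" where
  "admits_LHV_model _ N S L P \<longleftrightarrow>
     (\<exists>(\<nu> :: 'w measure) k. prob_space \<nu> \<and>
        (\<forall>n\<in>{1..N}. \<forall>s\<in>{1..S n}. conditional_distribution \<nu> (L n s) (k n s)) \<and>
        LHV_representation N S L P \<nu> k)"

definition admits_regular_LHV_model ::
  "'w itself \<Rightarrow> nat \<Rightarrow> (nat \<Rightarrow> nat) \<Rightarrow> (nat \<Rightarrow> nat \<Rightarrow> 'a measure) \<Rightarrow>
   ((nat \<Rightarrow> nat) \<Rightarrow> (nat \<Rightarrow> 'a) measure) \<Rightarrow> bool" where
  "admits_regular_LHV_model _ N S L P \<longleftrightarrow>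
     (\<exists>(\<nu> :: 'w measure) k. prob_space \<nu> \<and>
        (\<forall>n\<in>{1..N}. \<forall>s\<in>{1..S n}. regular_conditional_distribution \<nu> (L n s) (k n s)) \<and>
        LHV_representation N S L P \<nu> k)"

text \<open>Measurably isomorphic to a Borel subset of the real line.\<close>

definition standard_borel :: "'a measure \<Rightarrow> bool" where
  "standard_borel M \<longleftrightarrow>
     (\<exists>f :: 'a \<Rightarrow> real. f \<in> borel_measurable M \<and> inj_on f (space M) \<and> (\<forall>A\<in>sets M. f ` A \<in> sets borel))"

text \<open>
  Why regularity is tied to \<open>standard_borel\<close>: let \<open>A \<subseteq> [0, 1]\<close> and its complement \<open>B\<close> in \<open>[0, 1]\<close>
  both have Lebesgue outer measure 1. Take \<open>N = 2\<close>, \<open>S 1 = 2\<close>, \<open>S 2 = 1\<close>, outcome spaces \<open>A\<close>, \<open>B\<close>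
  (site 1) and \<open>[0, 1]\<close> (site 2) with their Borel sets, and let both joint distributions be the
  law of \<open>x \<mapsto> (x, x)\<close>, for \<open>x\<close> distributed according to the trace of Lebesgue measure on \<open>A\<close> and
  on \<open>B\<close>. Both marginals at site 2 are Lebesgue measure, so the family is nonsignaling. A regular
  LHV model would give a probability measure on \<open>A \<times> B \<times> [0, 1]\<close> with almost surely equal
  coordinates, although \<open>A\<close> and \<open>B\<close> are disjoint.
\<close>

end

theory Submission
  imports Defs
begin

text \<open>
  The hidden variable is the joint outcome \<open>\<omega>\<close> of the sites \<open>2, \<dots>, N\<close>: by nonsignaling its law
  \<open>\<nu>\<close> does not depend on the setting at site 1. These sites answer deterministically with their
  component of \<open>\<omega>\<close>, and site 1 answers according to its conditional distribution given \<open>\<omega>\<close>, a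
  Radon-Nikodym derivative. If the outcome space is standard Borel, a regular version is
  obtained from conditional distribution functions at rational points.
\<close>

text \<open>Different settings of site 1 never occur in the same measurement, so their responses can
  be chosen independently of each other; each only has to reproduce its own joint law with the
  remaining outcomes. All that couples them is the common law \<open>\<nu>\<close>. The obstacle is
  null sets. A Radon-Nikodym derivative is fixed only up to a null set that depends on the event,
  and over an arbitrary outcome space there are uncountably many events, so the exceptional sets
  cannot simply be united. Every property of such a family, even monotonicity, is therefore an
  almost-everywhere statement about given events, and arguments must stay within countably many of
  them. This is why distribution functions are read off at rational points: countably many
  half-lines determine a probability measure on the line, so one null set suffices to build it. That
  the measure agrees with the original family on other Borel sets is then recovered event by
  event.\<close>

section \<open>Almost-everywhere calculus of conditional distributions\<close>

text \<open>Countable additivity along the constant sequence of empty sets makes a constant series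
  converge, which forces its term to vanish.\<close>

lemma conditional_distribution_empty:
  assumes "conditional_distribution \<nu> M k"
  shows "AE \<omega> in \<nu>. k {} \<omega> = 0"
proof -
  have "range (\<lambda>i::nat. {}) \<subseteq> sets M \<and> disjoint_family (\<lambda>i::nat. {})"
    by (auto simp: disjoint_family_on_def)
  then have "AE \<omega> in \<nu>. (\<lambda>i::nat. k {} \<omega>) sums k (\<Union>i::nat. {}) \<omega>"
    using assms unfolding conditional_distribution_def by blast
  then show ?thesis
    by eventually_elim (metis sums_summable summable_const_iff)
qed

text \<open>Apply countable additivity to the sequence A, B, {}, {}, ...; its tail contributes
  nothing outside the null set of the previous lemma.\<close>

lemma conditional_distribution_Un:
  assumes k: "conditional_distribution \<nu> M k"
    and AB: "A \<in> sets M" "B \<in> sets M" "A \<inter> B = {}"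
  shows "AE \<omega> in \<nu>. k (A \<union> B) \<omega> = k A \<omega> + k B \<omega>"
proof -
  have "range (binaryset A B) \<subseteq> sets M \<and> disjoint_family (binaryset A B)"
    using AB by (auto simp: range_binaryset_eq disjoint_family_on_def binaryset_def)
  then have "AE \<omega> in \<nu>. (\<lambda>i. k (binaryset A B i) \<omega>) sums k (\<Union>i. binaryset A B i) \<omega>"
    using k unfolding conditional_distribution_def by blast
  with conditional_distribution_empty[OF k] show ?thesis
  proof eventually_elim
    case (elim \<omega>)
    have "(\<lambda>i. k (binaryset A B i) \<omega>) sums (k A \<omega> + k B \<omega>)"
      by (rule binaryset_sums) fact
    with elim(2) show ?case
      by (simp add: UN_binaryset_eq sums_unique2)
  qed
qed

lemma conditional_distribution_mono:
  assumes k: "conditional_distribution \<nu> M k"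
    and AB: "A \<in> sets M" "B \<in> sets M" "A \<subseteq> B"
  shows "AE \<omega> in \<nu>. k A \<omega> \<le> k B \<omega>"
proof -
  have "AE \<omega> in \<nu>. k (A \<union> (B - A)) \<omega> = k A \<omega> + k (B - A) \<omega>"
    by (rule conditional_distribution_Un[OF k]) (use AB in auto)
  moreover have "AE \<omega> in \<nu>. 0 \<le> k (B - A) \<omega>"
    using k AB unfolding conditional_distribution_def by blast
  moreover have "A \<union> (B - A) = B" using AB by auto
  ultimately show ?thesis by auto
qed

lemma conditional_distribution_compl:
  assumes k: "conditional_distribution \<nu> M k" and A: "A \<in> sets M"
  shows "AE \<omega> in \<nu>. k (space M - A) \<omega> = 1 - k A \<omega>"
proof -
  have "AE \<omega> in \<nu>. k (A \<union> (space M - A)) \<omega> = k A \<omega> + k (space M - A) \<omega>"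
    by (rule conditional_distribution_Un[OF k]) (use A in auto)
  moreover have "AE \<omega> in \<nu>. k (space M) \<omega> = 1"
    using k unfolding conditional_distribution_def by blast
  moreover have "A \<union> (space M - A) = space M" using sets.sets_into_space[OF A] by auto
  ultimately show ?thesis by auto
qed

text \<open>The sets \<open>A n\<close> are split into disjoint increments. Partial sums over the
  increments telescope to \<open>k (A n)\<close>, and this uses countably many additivity
  statements, hence one null set.\<close>

lemma conditional_distribution_incseq:
  assumes k: "conditional_distribution \<nu> M k"
    and A: "range A \<subseteq> sets M" "incseq A"
  shows "AE \<omega> in \<nu>. (\<lambda>n. k (A n) \<omega>) \<longlonglongrightarrow> k (\<Union>n. A n) \<omega>"
proof -
  let ?D = "disjointed A"
  have D: "range ?D \<subseteq> sets M"
    using A(1) by (rule sets.range_disjointed_sets)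
  then have "AE \<omega> in \<nu>. (\<lambda>i. k (?D i) \<omega>) sums k (\<Union>i. ?D i) \<omega>"
    using k disjoint_family_disjointed[of A] unfolding conditional_distribution_def by blast
  moreover have "AE \<omega> in \<nu>. \<forall>n. k (A n \<union> ?D (Suc n)) \<omega> = k (A n) \<omega> + k (?D (Suc n)) \<omega>"
    unfolding AE_all_countable
  proof
    fix n
    show "AE \<omega> in \<nu>. k (A n \<union> ?D (Suc n)) \<omega> = k (A n) \<omega> + k (?D (Suc n)) \<omega>"
      by (rule conditional_distribution_Un[OF k])
        (use A D in \<open>auto simp: disjointed_mono[OF A(2)]\<close>)
  qed
  ultimately show ?thesis
  proof eventually_elim
    case (elim \<omega>)
    have step: "A n \<union> ?D (Suc n) = A (Suc n)" for n
      using incseq_SucD[OF A(2), of n] by (auto simp: disjointed_mono[OF A(2)])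
    have "(\<Sum>i<Suc n. k (?D i) \<omega>) = k (A n) \<omega>" for n
    proof (induction n)
      case 0
      then show ?case by (simp add: disjointed_def)
    next
      case (Suc n)
      then show ?case using elim(2)[rule_format, of n] by (simp add: step)
    qed
    moreover have "(\<lambda>n. \<Sum>i<Suc n. k (?D i) \<omega>) \<longlonglongrightarrow> k (\<Union>i. A i) \<omega>"
      using elim(1) LIMSEQ_Suc unfolding sums_def UN_disjointed_eq by blast
    ultimately show ?case by simp
  qed
qed

lemma conditional_distribution_decseq:
  assumes k: "conditional_distribution \<nu> M k"
    and A: "range A \<subseteq> sets M" "decseq A"
  shows "AE \<omega> in \<nu>. (\<lambda>n. k (A n) \<omega>) \<longlonglongrightarrow> k (\<Inter>n. A n) \<omega>"
proof -
  have "AE \<omega> in \<nu>. (\<lambda>n. k (space M - A n) \<omega>) \<longlonglongrightarrow> k (\<Union>n. space M - A n) \<omega>"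
    by (rule conditional_distribution_incseq[OF k]) (use A in \<open>auto simp: incseq_def decseq_def\<close>)
  moreover have "AE \<omega> in \<nu>. \<forall>n. k (space M - A n) \<omega> = 1 - k (A n) \<omega>"
    unfolding AE_all_countable
    by (intro allI conditional_distribution_compl[OF k]) (use A in auto)
  moreover have "AE \<omega> in \<nu>. k (space M - (\<Inter>n. A n)) \<omega> = 1 - k (\<Inter>n. A n) \<omega>"
    by (rule conditional_distribution_compl[OF k])
      (use A in \<open>auto intro!: sets.countable_INT\<close>)
  ultimately show ?thesis
  proof eventually_elim
    case (elim \<omega>)
    have "(\<Union>n. space M - A n) = space M - (\<Inter>n. A n)" by auto
    with elim have "(\<lambda>n. 1 - k (A n) \<omega>) \<longlonglongrightarrow> 1 - k (\<Inter>n. A n) \<omega>" by simp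
    from tendsto_diff[OF tendsto_const[of 1] this] show ?case by simp
  qed
qed

section \<open>Regular versions on standard Borel spaces\<close>

text \<open>Monotonicity of \<open>g\<close> is available at rational points only, and
  \<open>g\<close> need not be right-continuous there. The infimum over rationals strictly above x
  repairs both: it is defined for every real x and right-continuous by construction, though it may
  differ from \<open>g\<close> at a rational. The last claim is the bound used later to identify
  \<open>F\<close> almost everywhere.\<close>

lemma rational_cdf_extension:
  fixes g :: "real \<Rightarrow> real"
  assumes mono: "\<And>p q. p \<in> \<rat> \<Longrightarrow> q \<in> \<rat> \<Longrightarrow> p \<le> q \<Longrightarrow> g p \<le> g q"
    and bot: "(\<lambda>n. g (- real n)) \<longlonglongrightarrow> 0"
    and top: "(\<lambda>n. g (real n)) \<longlonglongrightarrow> 1"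
  defines "F \<equiv> \<lambda>x. INF q\<in>{q \<in> \<rat>. x < q}. g q"
  shows "real_distribution (interval_measure F)"
    and "measure (interval_measure F) {..x} = F x"
    and "q \<in> \<rat> \<Longrightarrow> x < q \<Longrightarrow> F x \<le> g q"
proof -
  have g0: "0 \<le> g p" if "p \<in> \<rat>" for p
  proof (rule LIMSEQ_le_const2[OF bot])
    obtain n where "- p \<le> real n" using real_arch_simple by blast
    then show "\<exists>N. \<forall>n\<ge>N. g (- real n) \<le> g p"
      using that by (intro exI[of _ n] allI impI mono) auto
  qed
  have g1: "g p \<le> 1" if "p \<in> \<rat>" for p
  proof (rule LIMSEQ_le_const[OF top])
    obtain n where "p \<le> real n" using real_arch_simple by blast
    then show "\<exists>N. \<forall>n\<ge>N. g p \<le> g (real n)"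
      using that by (intro exI[of _ n] allI impI mono) auto
  qed
  have bdd: "bdd_below (g ` {q \<in> \<rat>. x < q})" for x
    by (rule bdd_belowI[of _ 0]) (auto simp: g0)
  have ne: "{q \<in> \<rat>. x < q} \<noteq> {}" for x :: real
    using Rats_dense_in_real[of x "x + 1"] by auto
  have F_le: "F x \<le> g q" if "q \<in> \<rat>" "x < q" for x q
    unfolding F_def by (rule cINF_lower[OF bdd]) (use that in auto)
  have F_ge: "c \<le> F x" if "\<And>q. q \<in> \<rat> \<Longrightarrow> x < q \<Longrightarrow> c \<le> g q" for x c
    unfolding F_def by (rule cINF_greatest[OF ne]) (use that in auto)
  have mono_F: "F x \<le> F y" if "x \<le> y" for x y
    by (rule F_ge) (use that in \<open>auto intro: F_le\<close>)
  \<comment> \<open>If F a < u, some rational q > a has g q < u, and this one value bounds F on the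
    whole interval from a to q. The lower bound is monotonicity.\<close>
  have rc: "continuous (at_right a) F" for a
    unfolding continuous_within order_tendsto_iff eventually_at_right[OF less_add_one]
  proof safe
    show "\<exists>b>a. \<forall>y>a. y < b \<longrightarrow> F y < u" if Fu: "F a < u" for u
    proof -
      obtain q where "q \<in> \<rat>" "a < q" "g q < u"
        using Fu unfolding F_def by (auto simp: cINF_less_iff[OF ne bdd])
      then show ?thesis using F_le by (intro exI[of _ q]) (auto intro: le_less_trans)
    qed
    show "\<exists>b>a. \<forall>y>a. y < b \<longrightarrow> l < F y" if "l < F a" for l
      using less_le_trans[OF that mono_F] by (auto intro: less_add_one)
  qed
  have "F x \<ge> 0" for x by (rule F_ge) (rule g0)
  moreover have "F x \<le> 1" for x
    using ne[of x] F_le[of _ x] g1 by (auto intro: order_trans)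
  moreover have "\<exists>b. \<forall>x\<le>b. F x < e" if e: "0 < e" for e
  proof -
    obtain n where "g (- real n) < e"
      using order_tendstoD(2)[OF bot e] by (auto simp: eventually_sequentially)
    \<comment> \<open>The shift by 1 puts - n strictly above x, as the infimum defining F x
      requires.\<close>
    then have "F x < e" if "x \<le> - real n - 1" for x
      using F_le[of "- real n" x] that by force
    then show ?thesis by blast
  qed
  moreover have "\<exists>b. \<forall>x\<ge>b. e < F x" if e: "e < 1" for e
  proof -
    obtain n where n: "e < g (real n)"
      using order_tendstoD(1)[OF top e] by (auto simp: eventually_sequentially)
    have "g (real n) \<le> F x" if "real n \<le> x" for x
      by (rule F_ge) (use that in \<open>auto intro!: mono\<close>)
    then show ?thesis using n by (intro exI[of _ "real n"]) (auto intro: less_le_trans)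
  qed
  ultimately have lim: "(F \<longlongrightarrow> 0) at_bot" "(F \<longlongrightarrow> 1) at_top"
    by (auto simp: order_tendsto_iff eventually_at_bot_linorder eventually_at_top_linorder
        intro: less_le_trans le_less_trans)
  show "real_distribution (interval_measure F)"
    by (rule real_distribution_interval_measure[OF mono_F rc lim])
  show "measure (interval_measure F) {..x} = F x"
    by (rule measure_interval_measure_Iic[OF mono_F rc lim(1)])
  show "q \<in> \<rat> \<Longrightarrow> x < q \<Longrightarrow> F x \<le> g q"
    by (rule F_le)
qed

text \<open>The map \<open>f\<close> transports the problem to the real line, where distribution
  functions yield genuine measures; these are carried back along the inverse of \<open>f\<close>.
  Agreement with \<open>k\<close> still has an exceptional set depending on D, which is harmless
  under an integral.\<close>

theorem exists_regular_version:
  assumes k: "conditional_distribution \<nu> M k" and M: "standard_borel M"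
  obtains k' where "regular_conditional_distribution \<nu> M k'"
    and "\<And>D. D \<in> sets M \<Longrightarrow> AE \<omega> in \<nu>. k' D \<omega> = k D \<omega>"
proof -
  obtain f :: "'b \<Rightarrow> real" where f[measurable]: "f \<in> borel_measurable M"
    and inj: "inj_on f (space M)" and img: "\<And>A. A \<in> sets M \<Longrightarrow> f ` A \<in> sets borel"
    using M unfolding standard_borel_def by blast
  \<comment> \<open>\<open>h\<close> is the image of \<open>k\<close> under \<open>f\<close>, a
    conditional distribution on the Borel sets of the line.\<close>
  define h where "h B = k (f -` B \<inter> space M)" for B :: "real set"
  note kc = k[unfolded conditional_distribution_def]
  have vim: "f -` B \<inter> space M \<in> sets M" if "B \<in> sets borel" for B
    using measurable_sets[OF f that] .
  have h_meas[measurable]: "h B \<in> borel_measurable \<nu>" if "B \<in> sets borel" for B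
    using kc vim[OF that] unfolding h_def by blast
  have h: "conditional_distribution \<nu> borel h"
    unfolding conditional_distribution_def
  proof (intro conjI ballI allI impI)
    fix D :: "nat \<Rightarrow> real set" assume D: "range D \<subseteq> sets borel \<and> disjoint_family D"
    have "range (\<lambda>i. f -` D i \<inter> space M) \<subseteq> sets M \<and> disjoint_family (\<lambda>i. f -` D i \<inter> space M)"
      using D vim unfolding disjoint_family_on_def by blast
    then have "AE \<omega> in \<nu>. (\<lambda>i. k (f -` D i \<inter> space M) \<omega>) sums k (\<Union>i. f -` D i \<inter> space M) \<omega>"
      using kc by blast
    moreover have "(\<Union>i. f -` D i \<inter> space M) = f -` (\<Union>i. D i) \<inter> space M" by auto
    ultimately show "AE \<omega> in \<nu>. (\<lambda>i. h (D i) \<omega>) sums h (\<Union>i. D i) \<omega>"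
      by (simp add: h_def)
  next
    show "AE \<omega> in \<nu>. 0 \<le> h D \<omega>" if "D \<in> sets borel" for D
      using kc vim[OF that] unfolding h_def by blast
    show "AE \<omega> in \<nu>. h (space borel) \<omega> = 1"
      using kc by (simp add: h_def)
  qed (rule h_meas)
  define g where "g \<omega> q = h {..q} \<omega>" for \<omega> q
  \<comment> \<open>These are the hypotheses of \<open>rational_cdf_extension\<close>. They involve
    countably many half-lines, so they hold simultaneously outside one null set.\<close>
  define good where "good \<omega> \<longleftrightarrow> (\<forall>p\<in>\<rat>. \<forall>q\<in>\<rat>. p \<le> q \<longrightarrow> g \<omega> p \<le> g \<omega> q) \<and>
    (\<lambda>n. g \<omega> (- real n)) \<longlonglongrightarrow> 0 \<and> (\<lambda>n. g \<omega> (real n)) \<longlonglongrightarrow> 1" for \<omega>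
  have "AE \<omega> in \<nu>. good \<omega>"
  proof -
    have "AE \<omega> in \<nu>. \<forall>p\<in>\<rat>. \<forall>q\<in>\<rat>. p \<le> q \<longrightarrow> g \<omega> p \<le> g \<omega> q"
      by (subst AE_ball_countable, rule countable_rat, intro ballI,
          subst AE_ball_countable, rule countable_rat, intro ballI)
        (auto simp: g_def intro!: conditional_distribution_mono[OF h])
    moreover have "AE \<omega> in \<nu>. (\<lambda>n. g \<omega> (- real n)) \<longlonglongrightarrow> 0"
    proof -
      have "AE \<omega> in \<nu>. (\<lambda>n. h {..- real n} \<omega>) \<longlonglongrightarrow> h (\<Inter>n. {..- real n}) \<omega>"
        by (rule conditional_distribution_decseq[OF h]) (auto simp: decseq_def)
      moreover have "(\<Inter>n. {..- real n}) = {}"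
        by auto (metis neg_le_iff_le minus_minus linorder_not_le reals_Archimedean2)
      ultimately show ?thesis
        using conditional_distribution_empty[OF h] by (auto simp: g_def)
    qed
    moreover have "AE \<omega> in \<nu>. (\<lambda>n. g \<omega> (real n)) \<longlonglongrightarrow> 1"
    proof -
      have "AE \<omega> in \<nu>. (\<lambda>n. h {..real n} \<omega>) \<longlonglongrightarrow> h (\<Union>n. {..real n}) \<omega>"
        by (rule conditional_distribution_incseq[OF h]) (auto simp: incseq_def)
      moreover have "(\<Union>n. {..real n}) = UNIV"
        using real_arch_simple by auto
      moreover have "AE \<omega> in \<nu>. h UNIV \<omega> = 1"
        using h unfolding conditional_distribution_def by auto
      ultimately show ?thesis
        by (auto simp: g_def)
    qed
    ultimately show ?thesis
      unfolding good_def by eventually_elim blast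
  qed
  \<comment> \<open>\<open>Z\<close> is a measurable null set covering all bad points, so case
    distinctions on it preserve measurability.\<close>
  then obtain Z where Z: "Z \<in> null_sets \<nu>" "{\<omega>\<in>space \<nu>. \<not> good \<omega>} \<subseteq> Z"
    by (auto simp: eventually_ae_filter)
  then have [measurable]: "Z \<in> sets \<nu>" by auto
  have AE_Z: "AE \<omega> in \<nu>. \<omega> \<notin> Z" using Z(1) by (rule AE_not_in)
  define F where "F \<omega> x = (INF q\<in>{q \<in> \<rat>. x < q}. g \<omega> q)" for \<omega> x
  \<comment> \<open>The point mass at 0 is an arbitrary default that makes \<open>Q \<omega>\<close>
    a probability measure at every point of the space, constant on \<open>Z\<close>.\<close>
  define Q where "Q \<omega> = (if \<omega> \<in> Z then return borel 0 else interval_measure (F \<omega>))" for \<omega>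
  have good: "good \<omega>" if "\<omega> \<in> space \<nu>" "\<omega> \<notin> Z" for \<omega> using Z(2) that by auto
  have sets_Q: "sets (Q \<omega>) = sets borel" for \<omega> by (simp add: Q_def)
  have prob_Q: "prob_space (Q \<omega>)" if "\<omega> \<in> space \<nu>" for \<omega>
  proof (cases "\<omega> \<in> Z")
    case False
    then have "real_distribution (Q \<omega>)"
      using good[OF that False] unfolding Q_def F_def good_def
      by (auto intro!: rational_cdf_extension(1))
    then show ?thesis unfolding real_distribution_def by blast
  qed (auto simp: Q_def intro!: prob_space_return)
  have Q_Iic: "measure (Q \<omega>) {..x} = F \<omega> x" if "\<omega> \<in> space \<nu>" "\<omega> \<notin> Z" for \<omega> x
    using good[OF that] that(2) unfolding Q_def F_def good_def
    by (auto intro!: rational_cdf_extension(2))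
  have F_meas[measurable]: "(\<lambda>\<omega>. F \<omega> x) \<in> borel_measurable \<nu>" for x
  proof -
    have "countable {q \<in> \<rat>. x < q}"
      by (rule countable_subset[OF _ countable_rat]) auto
    then show ?thesis
      unfolding F_def g_def by (intro borel_measurable_cINF_real) auto
  qed
  have F_eq: "AE \<omega> in \<nu>. F \<omega> x = h {..x} \<omega>" for x
  proof -
    \<comment> \<open>Points strictly above x and decreasing to it leave room for a rational between
      x and \<open>?a n\<close>. This traps F at x between \<open>h {..x}\<close> and
      \<open>h {..?a n}\<close>, and the latter tends to the former.\<close>
    let ?a = "\<lambda>n. x + 1 / real (Suc n)"
    have Int_a: "(\<Inter>n. {..?a n}) = {..x}"
    proof (intro antisym subsetI)
      fix y assume y: "y \<in> (\<Inter>n. {..?a n})"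
      show "y \<in> {..x}"
      proof (rule ccontr)
        assume "y \<notin> {..x}"
        then obtain n where "inverse (real (Suc n)) < y - x"
          using reals_Archimedean[of "y - x"] by auto
        moreover have "y \<le> ?a n" using y by blast
        ultimately show False by (simp add: inverse_eq_divide)
      qed
    qed (auto intro: order_trans)
    have "AE \<omega> in \<nu>. (\<lambda>n. h {..?a n} \<omega>) \<longlonglongrightarrow> h (\<Inter>n. {..?a n}) \<omega>"
      by (rule conditional_distribution_decseq[OF h])
        (auto simp: decseq_def field_simps intro: order_trans)
    moreover have "AE \<omega> in \<nu>. \<forall>q\<in>\<rat>. x \<le> q \<longrightarrow> h {..x} \<omega> \<le> g \<omega> q"
      by (subst AE_ball_countable, rule countable_rat)
        (auto simp: g_def intro!: conditional_distribution_mono[OF h])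
    moreover have "AE \<omega> in \<nu>. \<forall>n. \<forall>q\<in>\<rat>. q \<le> ?a n \<longrightarrow> g \<omega> q \<le> h {..?a n} \<omega>"
      unfolding AE_all_countable
      by (intro allI, subst AE_ball_countable, rule countable_rat)
        (auto simp: g_def intro!: conditional_distribution_mono[OF h])
    ultimately show ?thesis
      using AE_Z AE_space
    proof eventually_elim
      case (elim \<omega>)
      have gd: "good \<omega>" using elim good by blast
      have ne: "{q \<in> \<rat>. x < q} \<noteq> {}"
        using Rats_dense_in_real[of x "x + 1"] by auto
      have "h {..x} \<omega> \<le> F \<omega> x"
        unfolding F_def by (rule cINF_greatest[OF ne]) (use elim(2) in auto)
      moreover have "F \<omega> x \<le> h {..?a n} \<omega>" for n
      proof -
        obtain q where q: "q \<in> \<rat>" "x < q" "q < ?a n"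
          using Rats_dense_in_real[of x "?a n"] by auto
        have "F \<omega> x \<le> g \<omega> q"
          unfolding F_def using gd q unfolding good_def
          by (intro rational_cdf_extension(3)) auto
        also have "\<dots> \<le> h {..?a n} \<omega>"
          using elim(3) q by (metis less_imp_le)
        finally show ?thesis .
      qed
      then have "F \<omega> x \<le> h {..x} \<omega>"
        using elim(1) unfolding Int_a by (intro LIMSEQ_le_const[of "\<lambda>n. h {..?a n} \<omega>"]) auto
      ultimately show ?case by simp
    qed
  qed
  \<comment> \<open>Dynkin induction from half-lines. Measurability is carried along because
    \<open>\<nu>\<close> is not assumed complete, so it would not follow from almost-everywhere
    equality with \<open>h A\<close>.\<close>
  have Q_h: "(\<lambda>\<omega>. measure (Q \<omega>) A) \<in> borel_measurable \<nu> \<and> (AE \<omega> in \<nu>. measure (Q \<omega>) A = h A \<omega>)"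
    if A: "A \<in> sets borel" for A
  proof -
    let ?G = "range (\<lambda>x::real. {..x})"
    have G: "sets borel = sigma_sets UNIV ?G"
      by (subst borel_eq_atMost) simp
    have IG: "Int_stable ?G"
      by (auto simp: Int_stable_def)
    have "?G \<subseteq> Pow UNIV" by simp
    from IG this A[unfolded G] show ?thesis
    proof (induction rule: sigma_sets_induct_disjoint)
      case (basic A)
      then obtain x where x: "A = {..x}" by auto
      have "(\<lambda>\<omega>. measure (Q \<omega>) A) \<in> borel_measurable \<nu> \<longleftrightarrow>
        (\<lambda>\<omega>. if \<omega> \<in> Z then indicator A (0::real) else F \<omega> x) \<in> borel_measurable \<nu>"
        by (rule measurable_cong) (auto simp: x Q_Iic, auto simp: Q_def measure_return)
      moreover have "AE \<omega> in \<nu>. measure (Q \<omega>) A = h A \<omega>"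
        using F_eq[of x] AE_Z AE_space by eventually_elim (simp add: x Q_Iic)
      ultimately show ?case by simp
    next
      case empty
      then show ?case using conditional_distribution_empty[OF h] by auto
    next
      case (compl A)
      have A: "A \<in> sets borel" using compl(1) G by simp
      have c: "measure (Q \<omega>) (UNIV - A) = 1 - measure (Q \<omega>) A" if "\<omega> \<in> space \<nu>" for \<omega>
        using prob_space.prob_compl[OF prob_Q[OF that], of A] A sets_Q[of \<omega>]
          sets_eq_imp_space_eq[OF sets_Q[of \<omega>]] by simp
      have "(\<lambda>\<omega>. measure (Q \<omega>) (UNIV - A)) \<in> borel_measurable \<nu>"
        using compl by (subst measurable_cong[OF c]) auto
      moreover have "AE \<omega> in \<nu>. measure (Q \<omega>) (UNIV - A) = h (UNIV - A) \<omega>"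
        using conjunct2[OF compl(2)] conditional_distribution_compl[OF h A] AE_space
        by eventually_elim (simp add: c)
      ultimately show ?case by simp
    next
      case (union A)
      have A: "range A \<subseteq> sets borel" using union(2) G by simp
      have s: "(\<lambda>i. measure (Q \<omega>) (A i)) sums measure (Q \<omega>) (\<Union>i. A i)" if "\<omega> \<in> space \<nu>" for \<omega>
      proof -
        interpret prob_space "Q \<omega>" by (rule prob_Q[OF that])
        show ?thesis using A union(1) by (intro finite_measure_UNION) (auto simp: sets_Q)
      qed
      have "(\<lambda>\<omega>. \<Sum>i. measure (Q \<omega>) (A i)) \<in> borel_measurable \<nu>"
        using union(3) by (intro borel_measurable_suminf) auto
      then have "(\<lambda>\<omega>. measure (Q \<omega>) (\<Union>i. A i)) \<in> borel_measurable \<nu>"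
        by (rule measurable_cong[THEN iffD1, rotated]) (use s in \<open>auto simp: sums_iff\<close>)
      moreover have "AE \<omega> in \<nu>. measure (Q \<omega>) (\<Union>i. A i) = h (\<Union>i. A i) \<omega>"
      proof -
        have "AE \<omega> in \<nu>. \<forall>i. measure (Q \<omega>) (A i) = h (A i) \<omega>"
          unfolding AE_all_countable using union(3) by blast
        moreover have "AE \<omega> in \<nu>. (\<lambda>i. h (A i) \<omega>) sums h (\<Union>i. A i) \<omega>"
          using h A union(1) unfolding conditional_distribution_def by blast
        ultimately show ?thesis
          using AE_space
        proof eventually_elim
          case (elim \<omega>)
          have "(\<lambda>i. h (A i) \<omega>) sums measure (Q \<omega>) (\<Union>i. A i)"
            using s[OF elim(3)] elim(1) by simp
          then show ?case using elim(2) sums_unique2 by blast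
        qed
      qed
      ultimately show ?case by simp
    qed
  qed
  define k' where "k' D \<omega> = measure (Q \<omega>) (f ` D)" for D \<omega>
  have k'_k: "AE \<omega> in \<nu>. k' D \<omega> = k D \<omega>" if D: "D \<in> sets M" for D
  proof -
    have "f -` (f ` D) \<inter> space M = D"
      using sets.sets_into_space[OF D] inj by (auto dest: inj_onD)
    then show ?thesis
      using conjunct2[OF Q_h[OF img[OF D]]] by (simp add: k'_def h_def)
  qed
  have "regular_conditional_distribution \<nu> M k'"
    unfolding regular_conditional_distribution_def
  proof
    show "\<forall>D\<in>sets M. k' D \<in> borel_measurable \<nu>"
      using Q_h[OF img] by (auto simp: k'_def[abs_def])
    \<comment> \<open>\<open>Q \<omega>\<close> might charge points outside the image of
      \<open>f\<close>. Total mass 1 on that image excludes this, and this single event supplies the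
      null set outside which restricting and pulling back gives a probability measure for all D at
      once.\<close>
    have "AE \<omega> in \<nu>. k' (space M) \<omega> = 1"
      using k'_k[OF sets.top] kc by auto
    then show "AE \<omega> in \<nu>. \<exists>R. prob_space R \<and> sets R = sets M \<and> (\<forall>D\<in>sets M. k' D \<omega> = measure R D)"
      using AE_space
    proof eventually_elim
      case (elim \<omega>)
      let ?E = "f ` space M"
      let ?i = "inv_into (space M) f"
      let ?T = "restrict_space (Q \<omega>) ?E"
      have E: "?E \<in> sets (Q \<omega>)" using img[OF sets.top] by (simp add: sets_Q)
      have space_Q: "space (Q \<omega>) = UNIV" using sets_eq_imp_space_eq[OF sets_Q] by simp
      have pre: "?i -` D \<inter> ?E = f ` D" if "D \<in> sets M" for D
        using sets.sets_into_space[OF that] inj by (auto simp: inv_into_f_f subset_iff)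
      have i: "?i \<in> measurable ?T M"
      proof (rule measurableI)
        show "?i x \<in> space M" if "x \<in> space ?T" for x
          using that by (auto simp: space_restrict_space intro: inv_into_into)
        show "?i -` D \<inter> space ?T \<in> sets ?T" if "D \<in> sets M" for D
        proof -
          have "f ` D \<subseteq> ?E" using sets.sets_into_space[OF that] by auto
          then show ?thesis
            using pre[OF that] E img[OF that]
            by (simp add: space_restrict_space space_Q sets_restrict_space_iff sets_Q)
        qed
      qed
      have eq: "emeasure (distr ?T M ?i) D = emeasure (Q \<omega>) (f ` D)" if D: "D \<in> sets M" for D
      proof -
        have "f ` D \<subseteq> ?E" using sets.sets_into_space[OF D] by auto
        then show ?thesis
          using E pre[OF D] by (simp add: emeasure_distr[OF i D] space_restrict_space space_Q
              emeasure_restrict_space)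
      qed
      interpret prob_space "Q \<omega>" by (rule prob_Q) fact
      have "prob_space (distr ?T M ?i)"
        using eq[OF sets.top] elim(1)
        by (intro prob_spaceI) (simp add: emeasure_eq_measure k'_def)
      then show ?case
        using eq by (intro exI[of _ "distr ?T M ?i"]) (auto simp: measure_def k'_def)
    qed
  qed
  then show thesis using k'_k that by blast
qed

section \<open>Conditional distributions as Radon-Nikodym derivatives\<close>

text \<open>For fixed D, the measure sending B to the probability of X in D and Y in B is dominated
  by the law of Y; \<open>k D\<close> is its density. Almost-everywhere uniqueness of densities
  turns identities between these measures into normalization and countable additivity of
  \<open>k\<close>.\<close>

lemma exists_conditional_distribution:
  assumes "prob_space P"
    and X[measurable]: "X \<in> measurable P M" and Y[measurable]: "Y \<in> measurable P V"
  obtains k where "conditional_distribution (distr P V Y) M k"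
    and "\<And>D B. D \<in> sets M \<Longrightarrow> B \<in> sets V \<Longrightarrow>
      measure P (X -` D \<inter> Y -` B \<inter> space P) = (\<integral>\<omega>. k D \<omega> * indicator B \<omega> \<partial>distr P V Y)"
proof -
  interpret P: prob_space P by fact
  define \<nu> where "\<nu> = distr P V Y"
  interpret \<nu>: prob_space \<nu> unfolding \<nu>_def by (rule P.prob_space_distr) measurable
  have sets_\<nu>: "sets \<nu> = sets V" and space_\<nu>: "space \<nu> = space V" by (simp_all add: \<nu>_def)
  define \<mu> where "\<mu> D = distr (density P (indicator (X -` D \<inter> space P))) V Y" for D
  have sets_\<mu>: "sets (\<mu> D) = sets \<nu>" for D by (simp add: \<mu>_def sets_\<nu>)
  have e\<mu>: "emeasure (\<mu> D) B = emeasure P (X -` D \<inter> Y -` B \<inter> space P)"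
    if [measurable]: "D \<in> sets M" "B \<in> sets V" for D B
  proof -
    have D: "X -` D \<inter> space P \<in> sets P" and B: "Y -` B \<inter> space P \<in> sets P" by measurable
    have "emeasure (\<mu> D) B = emeasure P ((X -` D \<inter> space P) \<inter> (Y -` B \<inter> space P))"
      using D B by (simp add: \<mu>_def emeasure_distr emeasure_density flip: indicator_inter_arith)
    also have "(X -` D \<inter> space P) \<inter> (Y -` B \<inter> space P) = X -` D \<inter> Y -` B \<inter> space P" by auto
    finally show ?thesis .
  qed
  have fin: "finite_measure (\<mu> D)" if "D \<in> sets M" for D
    by (rule finite_measureI) (use e\<mu>[OF that sets.top] in \<open>simp add: \<mu>_def\<close>)
  have ac: "absolutely_continuous \<nu> (\<mu> D)" if D: "D \<in> sets M" for D
    unfolding absolutely_continuous_def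
  proof
    fix B assume "B \<in> null_sets \<nu>"
    then have B[measurable]: "B \<in> sets V" and z: "emeasure P (Y -` B \<inter> space P) = 0"
      by (auto simp: null_sets_def sets_\<nu> \<nu>_def emeasure_distr)
    have "emeasure P (X -` D \<inter> Y -` B \<inter> space P) \<le> emeasure P (Y -` B \<inter> space P)"
      by (intro emeasure_mono) auto
    with z have "emeasure (\<mu> D) B = 0" using e\<mu>[OF D B] by simp
    then show "B \<in> null_sets (\<mu> D)" using B by (auto simp: sets_\<mu> sets_\<nu>)
  qed
  define r where "r D = RN_deriv \<nu> (\<mu> D)" for D
  have r_meas[measurable]: "r D \<in> borel_measurable \<nu>" for D by (simp add: r_def)
  have dens: "density \<nu> (r D) = \<mu> D" if "D \<in> sets M" for D
    unfolding r_def by (rule \<nu>.density_RN_deriv[OF ac[OF that] sets_\<mu>])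
  \<comment> \<open>Needed for the passage to real values: \<open>enn2real\<close> sends infinity to
    0 and would lose mass there.\<close>
  have r_fin: "AE \<omega> in \<nu>. r D \<omega> \<noteq> \<infinity>" if "D \<in> sets M" for D
    unfolding r_def
    by (rule \<nu>.RN_deriv_finite[OF _ ac[OF that] sets_\<mu>])
      (use fin[OF that] in \<open>simp add: finite_measure.axioms\<close>)
  define k where "k D \<omega> = enn2real (r D \<omega>)" for D \<omega>
  have "conditional_distribution \<nu> M k"
    unfolding conditional_distribution_def
  proof (intro conjI ballI allI impI)
    show "k D \<in> borel_measurable \<nu>" for D unfolding k_def by measurable
    show "AE \<omega> in \<nu>. 0 \<le> k D \<omega>" for D by (simp add: k_def)
    have "density \<nu> (\<lambda>_. 1) = \<mu> (space M)"
    proof (rule measure_eqI)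
      fix B assume "B \<in> sets (density \<nu> (\<lambda>_. 1))"
      then have B: "B \<in> sets V" by (simp add: sets_\<nu>)
      have "X -` space M \<inter> Y -` B \<inter> space P = Y -` B \<inter> space P"
        using measurable_space[OF X] by auto
      then show "emeasure (density \<nu> (\<lambda>_. 1)) B = emeasure (\<mu> (space M)) B"
        using B by (simp add: density_1 e\<mu> \<nu>_def emeasure_distr)
    qed (simp add: sets_\<mu>)
    then have "AE \<omega> in \<nu>. 1 = r (space M) \<omega>"
      unfolding r_def by (intro \<nu>.RN_deriv_unique) auto
    then show "AE \<omega> in \<nu>. k (space M) \<omega> = 1"
      by eventually_elim (simp add: k_def flip: one_ennreal_def)
  next
    fix D :: "nat \<Rightarrow> _" assume D: "range D \<subseteq> sets M \<and> disjoint_family D"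
    then have Di: "D i \<in> sets M" for i by auto
    then have UD: "(\<Union>i. D i) \<in> sets M" by auto
    \<comment> \<open>The sum of the densities is itself a density of the measure belonging to the
      union, so uniqueness identifies it with the derivative for the union.\<close>
    have "density \<nu> (\<lambda>\<omega>. \<Sum>i. r (D i) \<omega>) = \<mu> (\<Union>i. D i)"
    proof (rule measure_eqI)
      fix B assume "B \<in> sets (density \<nu> (\<lambda>\<omega>. \<Sum>i. r (D i) \<omega>))"
      then have B[measurable]: "B \<in> sets \<nu>" by simp
      then have BV[measurable]: "B \<in> sets V" by (simp add: sets_\<nu>)
      have "emeasure (density \<nu> (\<lambda>\<omega>. \<Sum>i. r (D i) \<omega>)) B = (\<Sum>i. emeasure (density \<nu> (r (D i))) B)"
        by (simp add: emeasure_density nn_integral_suminf flip: ennreal_suminf_multc)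
      also have "\<dots> = (\<Sum>i. emeasure P (X -` D i \<inter> Y -` B \<inter> space P))"
        by (simp add: dens Di e\<mu> BV)
      also have "\<dots> = emeasure P (\<Union>i. X -` D i \<inter> Y -` B \<inter> space P)"
        using Di D by (intro suminf_emeasure) (auto simp: disjoint_family_on_def disjoint_iff)
      also have "(\<Union>i. X -` D i \<inter> Y -` B \<inter> space P) = X -` (\<Union>i. D i) \<inter> Y -` B \<inter> space P" by auto
      also have "emeasure P \<dots> = emeasure (\<mu> (\<Union>i. D i)) B"
        by (simp add: e\<mu>[OF UD BV])
      finally show "emeasure (density \<nu> (\<lambda>\<omega>. \<Sum>i. r (D i) \<omega>)) B = emeasure (\<mu> (\<Union>i. D i)) B" .
    qed (simp add: sets_\<mu>)
    then have "AE \<omega> in \<nu>. (\<Sum>i. r (D i) \<omega>) = r (\<Union>i. D i) \<omega>"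
      unfolding r_def[of "\<Union>i. D i"] by (intro \<nu>.RN_deriv_unique) auto
    moreover have "AE \<omega> in \<nu>. r (\<Union>i. D i) \<omega> \<noteq> \<infinity>" by (rule r_fin[OF UD])
    moreover have "AE \<omega> in \<nu>. \<forall>i. r (D i) \<omega> \<noteq> \<infinity>"
      unfolding AE_all_countable using r_fin[OF Di] by blast
    ultimately show "AE \<omega> in \<nu>. (\<lambda>i. k (D i) \<omega>) sums k (\<Union>i. D i) \<omega>"
    proof eventually_elim
      case (elim \<omega>)
      have kr: "r (D i) \<omega> = ennreal (k (D i) \<omega>)" for i
        using elim(3) by (simp add: k_def less_top)
      have "r (\<Union>i. D i) \<omega> = ennreal (k (\<Union>i. D i) \<omega>)"
        using elim(2) by (simp add: k_def less_top)
      with elim(1) have "(\<lambda>i. ennreal (k (D i) \<omega>)) sums ennreal (k (\<Union>i. D i) \<omega>)"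
        by (simp add: sums_iff kr)
      then show ?case by (subst (asm) sums_ennreal) (auto simp: k_def)
    qed
  qed
  moreover have "measure P (X -` D \<inter> Y -` B \<inter> space P) = (\<integral>\<omega>. k D \<omega> * indicator B \<omega> \<partial>\<nu>)"
    if D: "D \<in> sets M" and B: "B \<in> sets V" for D B
  proof -
    have [measurable]: "B \<in> sets \<nu>" using B by (simp add: sets_\<nu>)
    have "(\<integral>\<omega>. k D \<omega> * indicator B \<omega> \<partial>\<nu>) = enn2real (\<integral>\<^sup>+\<omega>. ennreal (k D \<omega> * indicator B \<omega>) \<partial>\<nu>)"
      by (intro integral_eq_nn_integral) (auto simp: k_def)
    also have "(\<integral>\<^sup>+\<omega>. ennreal (k D \<omega> * indicator B \<omega>) \<partial>\<nu>) = (\<integral>\<^sup>+\<omega>. r D \<omega> * indicator B \<omega> \<partial>\<nu>)"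
      by (intro nn_integral_cong_AE, use r_fin[OF D] in eventually_elim)
        (auto simp: k_def less_top split: split_indicator)
    also have "\<dots> = emeasure (\<mu> D) B"
      by (simp add: emeasure_density flip: dens[OF D])
    finally show ?thesis
      by (simp add: e\<mu>[OF D B] measure_def)
  qed
  ultimately show thesis using that unfolding \<nu>_def by blast
qed

section \<open>Assembly of the hidden variable model\<close>

text \<open>The deterministic responses of sites 2 to N multiply to the indicator of a box B, so the
  product formula reduces to the disintegration formula \<open>rep\<close> for D at site 1 and this
  B.\<close>

lemma LHV_representation_single_setting:
  assumes N: "1 \<le> N" and S: "\<And>n. n \<in> {2..N} \<Longrightarrow> S n = 1"
    and sets_P: "\<And>s. s \<in> settings N S \<Longrightarrow> sets (P s) = sets (outcome_space L {1..N} s)"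
    and space_\<nu>: "space \<nu> = space (\<Pi>\<^sub>M n\<in>{2..N}. L n 1)"
    and rep: "\<And>s D B. s \<in> settings N S \<Longrightarrow> D \<in> sets (L 1 (s 1)) \<Longrightarrow>
      B \<in> sets (\<Pi>\<^sub>M n\<in>{2..N}. L n 1) \<Longrightarrow>
      measure (P s) ((\<lambda>x. x 1) -` D \<inter> (\<lambda>x. restrict x {2..N}) -` B \<inter> space (P s)) =
        (\<integral>\<omega>. k (s 1) D \<omega> * indicator B \<omega> \<partial>\<nu>)"
  shows "LHV_representation N S L P \<nu> (\<lambda>n i. if n = 1 then k i else (\<lambda>D \<omega>. indicator D (\<omega> n)))"
  unfolding LHV_representation_def
proof (intro ballI allI impI)
  fix s D assume s: "s \<in> settings N S" and D: "\<forall>n\<in>{1..N}. D n \<in> sets (L n (s n))"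
  have sites: "{1..N} = insert 1 {2..N}" using N by auto
  have s1: "s n = 1" if "n \<in> {2..N}" for n
  proof -
    have "s n \<in> {1..S n}" using s that by (auto simp: settings_def PiE_iff)
    then show ?thesis using S[OF that] by simp
  qed
  let ?B = "\<Pi>\<^sub>E n\<in>{2..N}. D n"
  have B: "?B \<in> sets (\<Pi>\<^sub>M n\<in>{2..N}. L n 1)"
  proof (intro sets_PiM_I_finite ballI)
    show "D n \<in> sets (L n 1)" if "n \<in> {2..N}" for n
      using D that s1[OF that] by (metis sites insertI2)
  qed simp
  have DL: "D n \<subseteq> space (L n (s n))" if "n \<in> {1..N}" for n
    using D that sets.sets_into_space by blast
  have "space (P s) = (\<Pi>\<^sub>E n\<in>{1..N}. space (L n (s n)))"
    using sets_eq_imp_space_eq[OF sets_P[OF s]] by (simp add: outcome_space_def space_PiM)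
  then have "(\<Pi>\<^sub>E n\<in>{1..N}. D n) =
      (\<lambda>x. x 1) -` D 1 \<inter> (\<lambda>x. restrict x {2..N}) -` ?B \<inter> space (P s)"
    using DL unfolding sites by (auto simp: PiE_iff subset_iff)
  then have "measure (P s) (\<Pi>\<^sub>E n\<in>{1..N}. D n) = (\<integral>\<omega>. k (s 1) (D 1) \<omega> * indicator ?B \<omega> \<partial>\<nu>)"
    using rep[OF s _ B, of "D 1"] D N by simp
  also have "\<dots> = (\<integral>\<omega>. (\<Prod>n\<in>{1..N}.
      (if n = 1 then k (s n) else (\<lambda>D \<omega>. indicator D (\<omega> n))) (D n) \<omega>) \<partial>\<nu>)"
  proof (rule Bochner_Integration.integral_cong[OF refl])
    fix \<omega> assume "\<omega> \<in> space \<nu>"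
    \<comment> \<open>Membership in the box also demands the value \<open>undefined\<close> off its
      index set, which the product of indicators does not test.\<close>
    then have "\<omega> \<in> extensional {2..N}"
      by (auto simp: space_\<nu> space_PiM PiE_iff)
    then have "indicator ?B \<omega> = (\<Prod>n\<in>{2..N}. indicator (D n) (\<omega> n) :: real)"
      by (cases "\<forall>n\<in>{2..N}. \<omega> n \<in> D n") (auto simp: PiE_iff indicator_def) 
    then show "k (s 1) (D 1) \<omega> * indicator ?B \<omega> = (\<Prod>n\<in>{1..N}.
      (if n = 1 then k (s n) else (\<lambda>D \<omega>. indicator D (\<omega> n))) (D n) \<omega>)"
      unfolding sites by simp
  qed
  finally show "measure (P s) (\<Pi>\<^sub>E n\<in>{1..N}. D n) = (\<integral>\<omega>. (\<Prod>n\<in>{1..N}.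
      (if n = 1 then k (s n) else (\<lambda>D \<omega>. indicator D (\<omega> n))) (D n) \<omega>) \<partial>\<nu>)" .
qed

text \<open>The response is the point mass at the component of \<omega>, a probability measure on
  any measurable space; regularity is thus at stake only at site 1.\<close>

lemma regular_conditional_distribution_component:
  assumes "sets \<nu> = sets (\<Pi>\<^sub>M n\<in>J. M n)" and n: "n \<in> J"
  shows "regular_conditional_distribution \<nu> (M n) (\<lambda>D \<omega>. indicator D (\<omega> n))"
  unfolding regular_conditional_distribution_def
proof
  have [measurable]: "(\<lambda>\<omega>. \<omega> n) \<in> measurable \<nu> (M n)"
    using measurable_component_singleton[OF n, of M]
    by (simp cong: measurable_cong_sets add: assms(1))
  show "\<forall>D\<in>sets (M n). (\<lambda>\<omega>. indicator D (\<omega> n)) \<in> borel_measurable \<nu>"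
    by measurable
  show "AE \<omega> in \<nu>. \<exists>Q. prob_space Q \<and> sets Q = sets (M n) \<and>
      (\<forall>D\<in>sets (M n). indicator D (\<omega> n) = measure Q D)"
  proof (rule AE_I2)
    fix \<omega> assume "\<omega> \<in> space \<nu>"
    then have "\<omega> n \<in> space (M n)"
      by (rule measurable_space[rotated]) measurable
    then show "\<exists>Q. prob_space Q \<and> sets Q = sets (M n) \<and>
      (\<forall>D\<in>sets (M n). indicator D (\<omega> n) = measure Q D)"
      by (intro exI[of _ "return (M n) (\<omega> n)"]) (auto simp: prob_space_return measure_return)
  qed
qed

theorem proposition2:
  fixes N :: nat and S :: "nat \<Rightarrow> nat"
    and L :: "nat \<Rightarrow> nat \<Rightarrow> 'a measure"
    and P :: "(nat \<Rightarrow> nat) \<Rightarrow> (nat \<Rightarrow> 'a) measure"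
  assumes "measurement_family N S L P"
    and "2 \<le> S 1"
    and "\<forall>n\<in>{2..N}. S n = 1"
    and "nonsignaling N S L P"
  shows "admits_LHV_model TYPE(nat \<Rightarrow> 'a) N S L P \<and>
    ((\<forall>s\<in>{1..S 1}. standard_borel (L 1 s)) \<longrightarrow> admits_regular_LHV_model TYPE(nat \<Rightarrow> 'a) N S L P)"
proof -
  define V where "V = (\<Pi>\<^sub>M n\<in>{2..N}. L n 1)"
  define cfg :: "nat \<Rightarrow> nat \<Rightarrow> nat" where "cfg i = (\<lambda>n\<in>{1..N}. if n = 1 then i else 1)" for i
  \<comment> \<open>The reference setting 1 at site 1 is an arbitrary choice; any other gives the
    same law by nonsignaling.\<close>
  define \<nu> where "\<nu> = distr (P (cfg 1)) V (\<lambda>x. restrict x {2..N})"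
  have N: "1 \<le> N" and prob_P: "\<And>s. s \<in> settings N S \<Longrightarrow> prob_space (P s)"
    and sets_P: "\<And>s. s \<in> settings N S \<Longrightarrow> sets (P s) = sets (outcome_space L {1..N} s)"
    using assms(1) unfolding measurement_family_def by auto
  have S: "S n = 1" if "n \<in> {2..N}" for n using assms(3) that by blast
  have s1: "s n = 1" if "s \<in> settings N S" "n \<in> {2..N}" for s n
  proof -
    have "s n \<in> {1..S n}" using that by (auto simp: settings_def PiE_iff)
    then show ?thesis using S[OF that(2)] by simp
  qed
  have cfg: "cfg i \<in> settings N S" if "i \<in> {1..S 1}" for i
    using that S by (auto simp: cfg_def settings_def)
  have cfg_eq: "cfg (s 1) = s" if "s \<in> settings N S" for s
  proof (rule ext)
    fix n
    show "cfg (s 1) n = s n"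
    proof (cases "n \<in> {1..N}")
      case True
      then show ?thesis
        using s1[OF that, of n] by (cases "n = 1") (auto simp: cfg_def)
    next
      case False
      then show ?thesis using that by (auto simp: cfg_def settings_def PiE_iff extensional_def)
    qed
  qed
  have V: "outcome_space L {2..N} s = V" if "s \<in> settings N S" for s
    unfolding outcome_space_def V_def by (rule PiM_cong) (use s1[OF that] in auto)
  have rest_meas: "(\<lambda>x. restrict x {2..N}) \<in> measurable (P s) V" if s: "s \<in> settings N S" for s
    unfolding V[OF s, symmetric] outcome_space_def
    by (subst measurable_cong_sets[OF sets_P[OF s, unfolded outcome_space_def] refl])
      (auto intro!: measurable_restrict_subset)
  have fst_meas: "(\<lambda>x. x 1) \<in> measurable (P s) (L 1 (s 1))" if s: "s \<in> settings N S" for s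
    by (subst measurable_cong_sets[OF sets_P[OF s, unfolded outcome_space_def] refl])
      (use N in \<open>auto intro!: measurable_component_singleton\<close>)
  have cfg1: "cfg 1 \<in> settings N S" using assms(2) by (intro cfg) auto
  have sets_\<nu>: "sets \<nu> = sets V" by (simp add: \<nu>_def)
  have prob_\<nu>: "prob_space \<nu>"
    unfolding \<nu>_def by (rule prob_space.prob_space_distr[OF prob_P[OF cfg1] rest_meas[OF cfg1]])
  have \<nu>: "distr (P s) V (\<lambda>x. restrict x {2..N}) = \<nu>" if s: "s \<in> settings N S" for s
  proof (cases "N = 1")
    case True
    \<comment> \<open>\<^const>\<open>nonsignaling\<close> says nothing about the empty set of sites, but \<open>V\<close> is then a one-point space.\<close>
    interpret D: prob_space "distr (P s) V (\<lambda>x. restrict x {2..N})"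
      by (rule prob_space.prob_space_distr[OF prob_P[OF s] rest_meas[OF s]])
    interpret \<nu>: prob_space \<nu> by (rule prob_\<nu>)
    show ?thesis
    proof (rule measure_eqI)
      fix A assume "A \<in> sets (distr (P s) V (\<lambda>x. restrict x {2..N}))"
      then have "A = {} \<or> A = space V"
        using True by (auto simp: V_def sets_PiM_empty space_PiM_empty)
      then show "emeasure (distr (P s) V (\<lambda>x. restrict x {2..N})) A = emeasure \<nu> A"
        using D.emeasure_space_1 \<nu>.emeasure_space_1 sets_eq_imp_space_eq[OF sets_\<nu>] by auto
    qed (simp add: sets_\<nu>)
  next
    case False
    \<comment> \<open>Nonsignaling is used for this one set of sites, which is nonempty and proper
      because N is at least 2 here.\<close>
    then have J: "{2..N} \<noteq> {} \<and> {2..N} \<subset> {1..N} \<and> (\<forall>n\<in>{2..N}. s n = cfg 1 n)"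
      using N s1[OF s] s1[OF cfg1] by auto
    then have "marginal L P {2..N} s = marginal L P {2..N} (cfg 1)"
      using assms(4) s cfg1 unfolding nonsignaling_def by blast
    then show ?thesis
      unfolding marginal_def V[OF s] V[OF cfg1] \<nu>_def .
  qed
  define rep where "rep i k \<longleftrightarrow> (\<forall>D\<in>sets (L 1 i). \<forall>B\<in>sets V.
      measure (P (cfg i)) ((\<lambda>x. x 1) -` D \<inter> (\<lambda>x. restrict x {2..N}) -` B \<inter> space (P (cfg i))) =
        (\<integral>\<omega>. k D \<omega> * indicator B \<omega> \<partial>\<nu>))" for i and k :: "'a set \<Rightarrow> (nat \<Rightarrow> 'a) \<Rightarrow> real"
  \<comment> \<open>Disintegration yields the law of the remaining outcomes under setting i;
    rewriting it to the common \<open>\<nu>\<close> is what lets all settings share one hidden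
    variable.\<close>
  have "\<exists>k. conditional_distribution \<nu> (L 1 i) k \<and> rep i k" if i: "i \<in> {1..S 1}" for i
  proof -
    have "(\<lambda>x. x 1) \<in> measurable (P (cfg i)) (L 1 i)"
      using fst_meas[OF cfg[OF i]] N by (simp add: cfg_def)
    then show ?thesis
      by (rule exists_conditional_distribution[OF prob_P[OF cfg[OF i]] _ rest_meas[OF cfg[OF i]]])
        (unfold \<nu>[OF cfg[OF i]] rep_def, blast)
  qed
  then obtain k where k: "\<And>i. i \<in> {1..S 1} \<Longrightarrow> conditional_distribution \<nu> (L 1 i) (k i) \<and> rep i (k i)"
    by metis
  \<comment> \<open>The site 1 response stays a parameter, so that the same assembly serves the
    Radon-Nikodym family and its regular version.\<close>
  define kernels :: "(nat \<Rightarrow> 'a set \<Rightarrow> (nat \<Rightarrow> 'a) \<Rightarrow> real) \<Rightarrow> nat \<Rightarrow> nat \<Rightarrow> 'a set \<Rightarrow> (nat \<Rightarrow> 'a) \<Rightarrow> real"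
    where "kernels k = (\<lambda>n i. if n = 1 then k i else (\<lambda>D \<omega>. indicator D (\<omega> n)))" for k
  have rep_kernels: "LHV_representation N S L P \<nu> (kernels k)"
    if "\<And>i. i \<in> {1..S 1} \<Longrightarrow> rep i (k i)" for k
    unfolding kernels_def
  proof (rule LHV_representation_single_setting[OF N S sets_P])
    show "space \<nu> = space (\<Pi>\<^sub>M n\<in>{2..N}. L n 1)"
      using sets_eq_imp_space_eq[OF sets_\<nu>] by (simp add: V_def)
    fix s D B assume s: "s \<in> settings N S" and D: "D \<in> sets (L 1 (s 1))"
      and B: "B \<in> sets (\<Pi>\<^sub>M n\<in>{2..N}. L n 1)"
    have "s 1 \<in> {1..S 1}" using s N by (auto simp: settings_def PiE_iff)
    from that[OF this] D B
    show "measure (P s) ((\<lambda>x. x 1) -` D \<inter> (\<lambda>x. restrict x {2..N}) -` B \<inter> space (P s)) =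
        (\<integral>\<omega>. k (s 1) D \<omega> * indicator B \<omega> \<partial>\<nu>)"
      unfolding rep_def cfg_eq[OF s] V_def by blast
  qed
  have regular_component: "regular_conditional_distribution \<nu> (L n i) (kernels k n i)"
    if "n \<in> {1..N}" "i \<in> {1..S n}" "n \<noteq> 1" for n i k
  proof -
    have n: "n \<in> {2..N}" using that by auto
    then have "i = 1" using that(2) S by auto
    then show ?thesis
      using regular_conditional_distribution_component[OF sets_\<nu>[unfolded V_def] n] that(3)
      by (simp add: kernels_def)
  qed
  have "conditional_distribution \<nu> (L n i) (kernels k n i)" if "n \<in> {1..N}" "i \<in> {1..S n}" for n i
  proof (cases "n = 1")
    case True
    then show ?thesis using k that(2) by (simp add: kernels_def)
  qed (use regular_component that regular_conditional_distribution_imp in blast)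
  then have "admits_LHV_model TYPE(nat \<Rightarrow> 'a) N S L P"
    unfolding admits_LHV_model_def using prob_\<nu> rep_kernels k by blast
  moreover have "admits_regular_LHV_model TYPE(nat \<Rightarrow> 'a) N S L P"
    if sb: "\<forall>s\<in>{1..S 1}. standard_borel (L 1 s)"
  proof -
    have "\<exists>k'. regular_conditional_distribution \<nu> (L 1 i) k' \<and> rep i k'" if i: "i \<in> {1..S 1}" for i
    proof -
      obtain k' where reg: "regular_conditional_distribution \<nu> (L 1 i) k'"
        and eq: "\<And>D. D \<in> sets (L 1 i) \<Longrightarrow> AE \<omega> in \<nu>. k' D \<omega> = k i D \<omega>"
        using exists_regular_version k[OF i] sb i by metis
      \<comment> \<open>The representation sees the responses only through integrals, each involving
        one D, so an exceptional set depending on D does no harm.\<close>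
      have "(\<integral>\<omega>. k' D \<omega> * indicator B \<omega> \<partial>\<nu>) = (\<integral>\<omega>. k i D \<omega> * indicator B \<omega> \<partial>\<nu>)"
        if D: "D \<in> sets (L 1 i)" and B: "B \<in> sets V" for D B
      proof (rule integral_cong_AE)
        have [measurable]: "B \<in> sets \<nu>" using B sets_\<nu> by simp
        have [measurable]: "k' D \<in> borel_measurable \<nu>" "k i D \<in> borel_measurable \<nu>"
          using reg k[OF i] D
          unfolding regular_conditional_distribution_def conditional_distribution_def by blast+
        show "(\<lambda>\<omega>. k' D \<omega> * indicator B \<omega>) \<in> borel_measurable \<nu>"
          "(\<lambda>\<omega>. k i D \<omega> * indicator B \<omega>) \<in> borel_measurable \<nu>"
          by measurable
        show "AE \<omega> in \<nu>. k' D \<omega> * indicator B \<omega> = k i D \<omega> * indicator B \<omega>"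
          using eq[OF D] by eventually_elim simp
      qed
      then have "rep i k'" using k[OF i] unfolding rep_def by simp
      with reg show ?thesis by blast
    qed
    then obtain k' where k': "\<And>i. i \<in> {1..S 1} \<Longrightarrow>
        regular_conditional_distribution \<nu> (L 1 i) (k' i) \<and> rep i (k' i)"
      by metis
    have "regular_conditional_distribution \<nu> (L n i) (kernels k' n i)"
      if "n \<in> {1..N}" "i \<in> {1..S n}" for n i
    proof (cases "n = 1")
      case True
      then show ?thesis using k' that(2) by (simp add: kernels_def)
    qed (use regular_component that in blast)
    then show ?thesis
      unfolding admits_regular_LHV_model_def using prob_\<nu> rep_kernels k' by blast
  qed
  ultimately show ?thesis by blast
qed

end
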